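(* Let $\mathcal{H}_n$ be an $n$-dimensional Hilbert space and let $F=\{f_i\}_{i\in I_m}$ be a frame of $\mathcal{H}_n$ with a dual frame $G=\{g_i\}_{i\in I_m}$, such that $\operatorname{spark}F=r+1$. Then any $r$-erasures of dual frame coefficients can be recovered by solving the equation $\mathcal{G}_Fc=\theta_F^{*}f$; that is, for every $f\in\mathcal{H}_n$ and every $\Lambda\subset I_m$ with $|\Lambda|=r$, the erased coefficients $\{\langle f,g_i\rangle\}_{i\in\Lambda}$ are the unique solution, in the unknowns $\{c_i\}_{i\in\Lambda}$, of $\mathcal{G}_Fc=\theta_F^{*}f$, where $c=\{c_i\}_{i\in I_m}$ has the known entries $c_i=\langle f,g_i\rangle$ for $i\in I_m\setminus\Lambda$.
   Context: $I_m=\{1,\dots,m\}$; $\mathcal{H}_n$ is identified with $\mathbb{C}^n$ via an orthonormal basis; inner products are linear in the first variable. $F=\{f_i\}_{i\in I_m}$ is a frame if it spans $\mathcal{H}_n$; $F$ also denotes the $n\times m$ matrix with columns $f_i$; $\theta_F\{c_i\}=\sum_ic_if_i$, $\theta_F^{*}f=\{\langle f,f_i\rangle\}_i$, and $\mathcal{G}_F=F^{*}F$ is the Gramian matrix. $G$ is a dual frame of $F$ if $f=\sum_i\langle f,g_i\rangle f_i$ for all $f\in\mathcal{H}_n$; the dual frame coefficients of $f$ are $\{\langle f,g_i\rangle\}_{i\in I_m}$. The spark of a matrix is the size of the smallest linearly dependent subset of its columns ($+\infty$ if the columns are linearly independent). *)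

theory Defs
  imports
    "Jordan_Normal_Form.Schur_Decomposition"
    "Jordan_Normal_Form.VS_Connect"
    "HOL-Library.Extended_Nat"
begin

text \<open>The \<open>n\<close>-dimensional Hilbert space is \<open>carrier_vec n\<close> over the complex numbers with the inner
  product \<open>x \<bullet>c y\<close>, which is linear in the first variable. A finite family of \<open>m\<close> vectors is
  identified with the \<open>n \<times> m\<close> matrix whose columns are its members; the family is indexed by
  \<open>{0..<m}\<close> instead of \<open>{1..m}\<close>.\<close>

definition is_frame :: "nat \<Rightarrow> nat \<Rightarrow> complex mat \<Rightarrow> bool" where
  "is_frame n m F \<longleftrightarrow>
     F \<in> carrier_mat n m \<and>
     LinearCombinations.module.span class_ring (module_vec TYPE(complex) n) (set (cols F)) = carrier_vec n"

definition synthesis :: "complex mat \<Rightarrow> complex vec \<Rightarrow> complex vec" where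
  "synthesis F c =
     finsum_vec TYPE(complex) (dim_row F) (\<lambda>i. (c $ i) \<cdot>\<^sub>v col F i) {0..<dim_col F}"

definition analysis :: "complex mat \<Rightarrow> complex vec \<Rightarrow> complex vec" where
  "analysis F f = vec (dim_col F) (\<lambda>i. f \<bullet>c col F i)"

definition gramian :: "complex mat \<Rightarrow> complex mat" where
  "gramian F = mat_adjoint F * F"

definition is_dual_frame :: "nat \<Rightarrow> nat \<Rightarrow> complex mat \<Rightarrow> complex mat \<Rightarrow> bool" where
  "is_dual_frame n m F G \<longleftrightarrow>
     G \<in> carrier_mat n m \<and> (\<forall>f \<in> carrier_vec n. f = synthesis F (analysis G f))"

text \<open>Columns are counted with multiplicity: dependence is that of an indexed family, so two
  equal columns at different positions are linearly dependent.\<close>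

definition dependent_columns :: "complex mat \<Rightarrow> nat set \<Rightarrow> bool" where
  "dependent_columns F \<Lambda> \<longleftrightarrow>
     (\<exists>a. (\<exists>i\<in>\<Lambda>. a i \<noteq> 0) \<and>
          finsum_vec TYPE(complex) (dim_row F) (\<lambda>i. a i \<cdot>\<^sub>v col F i) \<Lambda> = 0\<^sub>v (dim_row F))"

text \<open>The infimum of the empty set is \<open>\<infinity>\<close>, which covers linearly independent columns.\<close>

definition spark :: "complex mat \<Rightarrow> enat" where
  "spark F = Inf {enat (card \<Lambda>) | \<Lambda>. \<Lambda> \<subseteq> {0..<dim_col F} \<and> dependent_columns F \<Lambda>}"

lemma synthesis_eq_mult_mat_vec:
  assumes "c \<in> carrier_vec (dim_col F)"
  shows "synthesis F c = F *\<^sub>v c"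
proof (rule eq_vecI)
  have V: "synthesis F c \<in> carrier_vec (dim_row F)"
    unfolding synthesis_def by (rule finsum_vec_closed) auto
  then show "dim_vec (synthesis F c) = dim_vec (F *\<^sub>v c)"
    by simp
  fix i assume "i < dim_vec (F *\<^sub>v c)"
  then have i: "i < dim_row F" by simp
  have "synthesis F c $ i = (\<Sum>j\<in>{0..<dim_col F}. ((c $ j) \<cdot>\<^sub>v col F j) $ i)"
    unfolding synthesis_def by (rule index_finsum_vec) (use i in auto)
  also have "\<dots> = (F *\<^sub>v c) $ i"
    using i assms by (auto simp: scalar_prod_def mult.commute intro!: sum.cong)
  finally show "synthesis F c $ i = (F *\<^sub>v c) $ i" .
qed

lemma gramian_index:
  assumes "i < dim_col F" "j < dim_col F"
  shows "gramian F $$ (i, j) = col F j \<bullet>c col F i"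
proof -
  have "row (mat_adjoint F) i = conjugate (col F i)"
    unfolding mat_adjoint_def using assms by (subst mat_of_rows_row) auto
  moreover have "dim_row (mat_adjoint F) = dim_col F"
    unfolding mat_adjoint_def by simp
  moreover have "conjugate (col F i) \<bullet> col F j = col F j \<bullet>c col F i"
    by (rule comm_scalar_prod[of _ "dim_row F"]) auto
  ultimately show ?thesis
    unfolding gramian_def using assms by simp
qed

end

theory Submission
  imports Defs
begin

text \<open>Writing \<open>d\<close> for the dual frame coefficients of \<open>f\<close>, duality gives \<open>F d = f\<close>, so \<open>d\<close> solves
  \<open>F\<^sup>* F d = F\<^sup>* f\<close>. If \<open>c\<close> is another solution, then \<open>F\<^sup>* F (c - d) = 0\<close>, hence \<open>F (c - d) = 0\<close>;
  since \<open>c - d\<close> is supported on \<open>r\<close> indices and any \<open>r\<close> columns are independent, \<open>c = d\<close>.\<close>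

lemma analysis_eq_adjoint_mult_vec:
  assumes "f \<in> carrier_vec (dim_row F)"
  shows "analysis F f = mat_adjoint F *\<^sub>v f"
proof (rule eq_vecI)
  fix i assume "i < dim_vec (mat_adjoint F *\<^sub>v f)"
  then have i: "i < dim_col F" by (simp add: mat_adjoint_def)
  have "conjugate (col F i) \<bullet> f = f \<bullet>c col F i"
    by (rule comm_scalar_prod[of _ "dim_row F"]) (use assms in auto)
  moreover have "row (mat_adjoint F) i = conjugate (col F i)"
    unfolding mat_adjoint_def using i by (subst mat_of_rows_row) auto
  ultimately show "analysis F f $ i = (mat_adjoint F *\<^sub>v f) $ i"
    using i by (simp add: analysis_def mat_adjoint_def)
qed (simp add: analysis_def mat_adjoint_def)

text \<open>Associativity of the matrix product, together with the reading of the adjoint as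
  \<open>analysis F\<close>. In this form \<open>F *\<^sub>v d = f\<close> can be substituted
  directly.\<close>

lemma gramian_mult_vec:
  assumes "c \<in> carrier_vec (dim_col F)"
  shows "gramian F *\<^sub>v c = analysis F (F *\<^sub>v c)"
proof -
  have adj: "mat_adjoint F \<in> carrier_mat (dim_col F) (dim_row F)"
    by (rule carrier_matI) (simp_all add: mat_adjoint_def)
  have F: "F \<in> carrier_mat (dim_row F) (dim_col F)"
    by (rule carrier_matI) (rule refl)+
  show ?thesis
    unfolding gramian_def assoc_mult_mat_vec[OF adj F assms]
    by (rule analysis_eq_adjoint_mult_vec[OF mult_mat_vec_carrier[OF F assms], symmetric])
qed

text \<open>Both sides expand to the same finite double sum, summed in opposite orders. This
  adjointness is what turns the Gramian's quadratic form into a squared norm.\<close>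

lemma inner_mult_vec_right:
  assumes "x \<in> carrier_vec (dim_col F)" "v \<in> carrier_vec (dim_row F)"
  shows "v \<bullet>c (F *\<^sub>v x) = analysis F v \<bullet>c x"
proof -
  have "v \<bullet>c (F *\<^sub>v x) = (\<Sum>i<dim_row F. \<Sum>j<dim_col F. v $ i * (cnj (F $$ (i,j)) * cnj (x $ j)))"
    using assms by (auto simp: scalar_prod_def sum_distrib_left lessThan_atLeast0 intro!: sum.cong)
  also have "\<dots> = (\<Sum>j<dim_col F. \<Sum>i<dim_row F. v $ i * (cnj (F $$ (i,j)) * cnj (x $ j)))"
    by (rule sum.swap)
  also have "\<dots> = analysis F v \<bullet>c x"
    using assms by (auto simp: scalar_prod_def analysis_def sum_distrib_right lessThan_atLeast0
        mult.assoc intro!: sum.cong)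
  finally show ?thesis .
qed

text \<open>The squared norm of \<open>F *\<^sub>v x\<close> is the inner product of
  \<open>gramian F *\<^sub>v x\<close> with \<open>x\<close>, hence zero, and the inner product is
  positive definite.\<close>

lemma gramian_kernel:
  assumes "x \<in> carrier_vec (dim_col F)" "gramian F *\<^sub>v x = 0\<^sub>v (dim_col F)"
  shows "F *\<^sub>v x = 0\<^sub>v (dim_row F)"
proof -
  have Fx: "F *\<^sub>v x \<in> carrier_vec (dim_row F)"
    using mult_mat_vec_carrier[of F "dim_row F" "dim_col F" x] assms(1) by simp
  have "(F *\<^sub>v x) \<bullet>c (F *\<^sub>v x) = 0\<^sub>v (dim_col F) \<bullet>c x"
    using inner_mult_vec_right[OF assms(1) Fx] gramian_mult_vec[OF assms(1)] assms(2) by simp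
  then have "(F *\<^sub>v x) \<bullet>c (F *\<^sub>v x) = 0"
    using assms(1) by simp
  then show ?thesis
    using conjugate_square_eq_0_vec[OF Fx] by simp
qed

lemma spark_le:
  assumes "\<Lambda> \<subseteq> {0..<dim_col F}" "dependent_columns F \<Lambda>"
  shows "spark F \<le> enat (card \<Lambda>)"
  unfolding spark_def using assms by (auto intro: Inf_lower)

text \<open>The entries of \<open>x\<close> on \<open>\<Lambda>\<close> serve as the coefficients of
  the dependence: since \<open>x\<close> vanishes elsewhere, the combination over
  \<open>\<Lambda>\<close> is already all of \<open>F *\<^sub>v x\<close>.\<close>

lemma dependent_columns_of_kernel:
  assumes "x \<in> carrier_vec (dim_col F)" "F *\<^sub>v x = 0\<^sub>v (dim_row F)"
    and "\<Lambda> \<subseteq> {0..<dim_col F}" "\<And>i. i \<in> {0..<dim_col F} - \<Lambda> \<Longrightarrow> x $ i = 0"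
    and "k \<in> \<Lambda>" "x $ k \<noteq> 0"
  shows "dependent_columns F \<Lambda>"
proof -
  let ?S = "finsum_vec TYPE(complex) (dim_row F) (\<lambda>i. (x $ i) \<cdot>\<^sub>v col F i) \<Lambda>"
  have fin: "finite \<Lambda>" using assms(3) finite_subset by blast
  have S: "?S \<in> carrier_vec (dim_row F)"
    by (rule finsum_vec_closed) auto
  have "?S = 0\<^sub>v (dim_row F)"
  proof (rule eq_vecI)
    fix i assume "i < dim_vec (0\<^sub>v (dim_row F) :: complex vec)"
    then have i: "i < dim_row F" by simp
    have "?S $ i = (\<Sum>j\<in>\<Lambda>. ((x $ j) \<cdot>\<^sub>v col F j) $ i)"
      by (rule index_finsum_vec) (use i fin in auto)
    also have "\<dots> = (\<Sum>j\<in>\<Lambda>. F $$ (i, j) * x $ j)"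
      using i assms(3) by (intro sum.cong) (auto simp: mult.commute)
    \<comment> \<open>The added terms are zero because \<open>x\<close> is supported on
      \<open>\<Lambda>\<close>.\<close>
    also have "\<dots> = (\<Sum>j\<in>{0..<dim_col F}. F $$ (i, j) * x $ j)"
      by (rule sum.mono_neutral_left) (use assms(3,4) in auto)
    also have "\<dots> = (F *\<^sub>v x) $ i"
      using i assms(1) by (auto simp: scalar_prod_def intro!: sum.cong)
    finally show "?S $ i = 0\<^sub>v (dim_row F) $ i" using assms(2) by simp
  qed (use S in auto)
  then show ?thesis
    unfolding dependent_columns_def using assms(5,6) by (intro exI[of _ "($) x"]) auto
qed

theorem corollary5p5:
  fixes n m r :: nat and F G :: "complex mat"
  assumes "is_frame n m F"
    and "is_dual_frame n m F G"
    and "spark F = enat (r + 1)"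
  shows "\<forall>f \<in> carrier_vec n. \<forall>\<Lambda>. \<Lambda> \<subseteq> {0..<m} \<and> card \<Lambda> = r \<longrightarrow>
    (\<forall>c \<in> carrier_vec m. (\<forall>i \<in> {0..<m} - \<Lambda>. c $ i = f \<bullet>c col G i) \<longrightarrow>
      (gramian F *\<^sub>v c = analysis F f \<longleftrightarrow> (\<forall>i \<in> \<Lambda>. c $ i = f \<bullet>c col G i)))"
proof (intro ballI allI impI, elim conjE)
  fix f :: "complex vec" and \<Lambda> and c :: "complex vec"
  assume f: "f \<in> carrier_vec n" and \<Lambda>: "\<Lambda> \<subseteq> {0..<m}" "card \<Lambda> = r"
    and c: "c \<in> carrier_vec m" and known: "\<forall>i \<in> {0..<m} - \<Lambda>. c $ i = f \<bullet>c col G i"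
  have F: "F \<in> carrier_mat n m" using assms(1) by (simp add: is_frame_def)
  have G: "G \<in> carrier_mat n m" using assms(2) by (simp add: is_dual_frame_def)
  define d where "d = analysis G f"
  have d: "d \<in> carrier_vec m" using G by (auto simp: d_def analysis_def)
  have d_index: "d $ i = f \<bullet>c col G i" if "i < m" for i
    using that G by (simp add: d_def analysis_def)
  have "f = synthesis F d"
    using assms(2) f unfolding is_dual_frame_def d_def by blast
  then have "F *\<^sub>v d = f"
    using synthesis_eq_mult_mat_vec[of d F] d F by simp
  then have gram_d: "gramian F *\<^sub>v d = analysis F f"
    using gramian_mult_vec[of d F] d F by simp
  have gram: "gramian F \<in> carrier_mat m m"
    by (rule carrier_matI) (use F in \<open>simp_all add: gramian_def mat_adjoint_def\<close>)
  show "gramian F *\<^sub>v c = analysis F f \<longleftrightarrow> (\<forall>i \<in> \<Lambda>. c $ i = f \<bullet>c col G i)"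
  proof
    \<comment> \<open>This direction is uniqueness; the converse says that the true coefficients do
      solve the equation.\<close>
    assume eq: "gramian F *\<^sub>v c = analysis F f"
    have "gramian F *\<^sub>v (c - d) = 0\<^sub>v m"
      using gram_d eq mult_minus_distrib_mat_vec[OF gram c d] F
      by (simp add: analysis_def)
    then have ker: "F *\<^sub>v (c - d) = 0\<^sub>v (dim_row F)"
      using gramian_kernel[of "c - d" F] F c d by simp
    show "\<forall>i \<in> \<Lambda>. c $ i = f \<bullet>c col G i"
    proof (rule ballI, rule ccontr)
      fix k assume k: "k \<in> \<Lambda>" "c $ k \<noteq> f \<bullet>c col G k"
      \<comment> \<open>The vector \<open>c - d\<close> is zero off \<open>\<Lambda>\<close>, where
        the coefficients are known, and nonzero at \<open>k\<close>.\<close>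
      have "dependent_columns F \<Lambda>"
        by (rule dependent_columns_of_kernel[OF _ ker, where k = k])
          (use k \<Lambda> F c d d_index known in auto)
      \<comment> \<open>As \<open>card \<Lambda> = r\<close>, the dependence would force
        \<open>r + 1 \<le> r\<close>.\<close>
      then show False
        using spark_le[of \<Lambda> F] \<Lambda> F assms(3) by simp
    qed
  next
    assume "\<forall>i \<in> \<Lambda>. c $ i = f \<bullet>c col G i"
    \<comment> \<open>Agreement on \<open>\<Lambda>\<close> is the assumption, and agreement off
      \<open>\<Lambda>\<close> is \<open>known\<close>.\<close>
    then have "c = d"
      using c d d_index known by (intro eq_vecI) auto
    then show "gramian F *\<^sub>v c = analysis F f" using gram_d by simp
  qed
qed

end
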